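(* Fix $\alpha\in(0,1)$ and let $(\widehat q_{\theta,\alpha},\widehat q_{S^n,\alpha})$ be the $\alpha$-VB solution, i.e. a minimizer of $\Psi_{n,\alpha}$ over $\Gamma=\Gamma_\theta\times\Gamma_{S^n}$. For any $\zeta\in(0,1)$, it holds with $\mathbb P^{(n)}_{\theta^\ast}$-probability at least $1-\zeta$ that, simultaneously for all probability measures $q_\theta\in\Gamma_\theta$ with $q_\theta\ll p_\theta$ and all probability measures $q_{S^n}\in\Gamma_{S^n}$ on $S^n$, $$\int \frac1n\,D^{(n)}_\alpha(\theta,\theta^\ast)\,\widehat q_{\theta,\alpha}(\theta)\,d\theta\ \le\ \frac{\alpha}{n(1-\alpha)}\,\Psi_{n,\alpha}(q_\theta,q_{S^n})+\frac{1}{n(1-\alpha)}\log(1/\zeta).$$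
   Context: Model. The data $Y^n=(Y_1,\dots,Y_n)$ have distribution $\mathbb P^{(n)}_\theta$ with density $p^{(n)}_\theta(Y^n)=p(Y^n\mid\theta)$, $\theta\in\Theta$. The parameter decomposes as $\theta=(\mu,\pi)$ and there is a discrete latent variable $S^n$ such that $$p(Y^n\mid\theta)=\sum_{s^n}p(Y^n\mid\mu,s^n)\,\pi_{s^n},\qquad \pi_{s^n}:=p(S^n=s^n\mid\theta),$$ where $p(Y^n\mid \mu,s^n)$ is the conditional density of $Y^n$ given $S^n=s^n$. The prior on $\theta$ has density $p_\theta$. The data are generated from $\mathbb P^{(n)}_{\theta^\ast}$ for a true parameter $\theta^\ast\in\Theta$. Divergences. $D(p\,\|\,q)=\int p\log(p/q)$ is the Kullback–Leibler divergence; for $\alpha\in(0,1)$, $D_\alpha(p\,\|\,q)=\frac{1}{\alpha-1}\log\int p^\alpha q^{1-\alpha}\,d\mu$ is the Rényi divergence; $D^{(n)}_\alpha(\theta,\theta^\ast):=D_\alpha\big[p^{(n)}_\theta\,\|\,p^{(n)}_{\theta^\ast}\big]$. Objective. $\Gamma=\Gamma_\theta\times\Gamma_{S^n}$ is a given family of product densities $q_\theta(\theta)\,q_{S^n}(s^n)$, with $\Gamma_\theta$ a family of probability densities on $\Theta$ and $\Gamma_{S^n}$ a family of probability mass functions on the values of $S^n$. Put $\ell_n(\theta)=\log p(Y^n\mid\theta)$, $\ell_n(\theta,\theta^\ast)=\ell_n(\theta)-\ell_n(\theta^\ast)$, $$\widehat\ell_n(\theta)=\sum_{s^n}q_{S^n}(s^n)\log\frac{p(Y^n\mid\mu,s^n)\,\pi_{s^n}}{q_{S^n}(s^n)},\qquad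 \Delta_J(q_\theta,q_{S^n})=\int_\Theta[\ell_n(\theta)-\widehat\ell_n(\theta)]\,q_\theta(d\theta)\ (\ge0),$$ $$\Psi_{n,\alpha}(q_\theta,q_{S^n})=-\int_\Theta\ell_n(\theta,\theta^\ast)\,q_\theta(d\theta)+\Delta_J(q_\theta,q_{S^n})+\alpha^{-1}D(q_\theta\,\|\,p_\theta).$$ Equivalently, $\Psi_{n,\alpha}(q_\theta,q_{S^n})=-\int_\Theta\sum_{s^n}q_{S^n}(s^n)\log\frac{p(Y^n\mid\mu,s^n)\pi_{s^n}}{p(Y^n\mid\theta^\ast)q_{S^n}(s^n)}\,q_\theta(d\theta)+\alpha^{-1}D(q_\theta\,\|\,p_\theta)$. The $\alpha$-VB solution is $(\widehat q_{\theta,\alpha},\widehat q_{S^n,\alpha})=\arg\min_{(q_\theta,q_{S^n})\in\Gamma}\Psi_{n,\alpha}(q_\theta,q_{S^n})$, which depends on the data $Y^n$ and is assumed to exist. *)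

theory Defs
  imports "HOL-Probability.Probability"
begin

text \<open>
  Log-likelihoods, divergences and the objective can be infinite, so they take values in
  \<^typ>\<open>ereal\<close>, and densities take values in \<^typ>\<open>ennreal\<close>.  The Bochner integral and
  \<^const>\<open>KL_divergence\<close> would return 0 instead of an infinite value and are not used.
\<close>

definition eln :: "ennreal \<Rightarrow> ereal" where
  "eln x = (if x = 0 then -\<infinity> else if x = \<infinity> then \<infinity> else ereal (ln (enn2real x)))"

text \<open>
  Integral of positive part minus integral of negative part.  It is the usual integral whenever
  one of the two parts is finite; otherwise the \<^typ>\<open>ereal\<close> convention \<open>\<infinity> - \<infinity> = \<infinity>\<close> applies.
\<close>

definition eintegral :: "'a measure \<Rightarrow> ('a \<Rightarrow> ereal) \<Rightarrow> ereal" where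
  "eintegral M f =
     enn2ereal (\<integral>\<^sup>+ x. e2ennreal (f x) \<partial>M) - enn2ereal (\<integral>\<^sup>+ x. e2ennreal (- f x) \<partial>M)"

definition prob_density :: "'a measure \<Rightarrow> ('a \<Rightarrow> ennreal) \<Rightarrow> bool" where
  "prob_density M f \<longleftrightarrow> f \<in> borel_measurable M \<and> (\<integral>\<^sup>+ x. f x \<partial>M) = 1"

text \<open>
  The usual conventions \<open>0 log (0/p) = 0\<close> and \<open>q log (q/0) = \<infinity>\<close> (for \<open>q > 0\<close>) come out of
  \<open>0 * (\<plusminus>\<infinity>) = 0\<close> in \<^typ>\<open>ereal\<close> and \<open>q / 0 = \<infinity>\<close> in \<^typ>\<open>ennreal\<close>.
\<close>

definition KL_div :: "'a measure \<Rightarrow> ('a \<Rightarrow> ennreal) \<Rightarrow> ('a \<Rightarrow> ennreal) \<Rightarrow> ereal" where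
  "KL_div M p q = eintegral M (\<lambda>x. enn2ereal (p x) * eln (p x / q x))"

text \<open>
  A probability density is finite almost everywhere, so passing to \<^typ>\<open>real\<close> for the powers
  does not change the integral.  Mutually singular densities get divergence \<open>\<infinity>\<close>.
\<close>

definition Renyi_div :: "real \<Rightarrow> 'a measure \<Rightarrow> ('a \<Rightarrow> ennreal) \<Rightarrow> ('a \<Rightarrow> ennreal) \<Rightarrow> ereal" where
  "Renyi_div \<alpha> M p q =
     ereal (1 / (\<alpha> - 1)) *
     eln (\<integral>\<^sup>+ x. ennreal (enn2real (p x) powr \<alpha> * enn2real (q x) powr (1 - \<alpha>)) \<partial>M)"

text \<open>
  Throughout, \<open>lik \<mu> s y\<close> is the conditional density of the data at \<open>y\<close> given \<open>S = s\<close>, and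
  \<open>latent \<theta>\<close> is the law of the latent variable under the parameter \<open>\<theta>\<close>, whose first component
  is \<open>\<mu>\<close>.
\<close>

definition complete_density ::
  "('m \<Rightarrow> 's \<Rightarrow> 'd \<Rightarrow> ennreal) \<Rightarrow> ('m \<times> 'w \<Rightarrow> 's pmf) \<Rightarrow> 'm \<times> 'w \<Rightarrow> 's \<Rightarrow> 'd \<Rightarrow> ennreal" where
  "complete_density lik latent \<theta> s y = lik (fst \<theta>) s y * ennreal (pmf (latent \<theta>) s)"

definition data_density ::
  "('m \<Rightarrow> 's \<Rightarrow> 'd \<Rightarrow> ennreal) \<Rightarrow> ('m \<times> 'w \<Rightarrow> 's pmf) \<Rightarrow> 'm \<times> 'w \<Rightarrow> 'd \<Rightarrow> ennreal" where
  "data_density lik latent \<theta> y = (\<integral>\<^sup>+ s. complete_density lik latent \<theta> s y \<partial>count_space UNIV)"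

definition log_lik ::
  "('m \<Rightarrow> 's \<Rightarrow> 'd \<Rightarrow> ennreal) \<Rightarrow> ('m \<times> 'w \<Rightarrow> 's pmf) \<Rightarrow> 'd \<Rightarrow> 'm \<times> 'w \<Rightarrow> ereal" where
  "log_lik lik latent y \<theta> = eln (data_density lik latent \<theta> y)"

text \<open>
  The sum over \<open>s\<close> is an integral over the counting measure; its positive part is finite as soon
  as the data density at \<open>y\<close> is, because \<open>q log (a/q) \<le> a\<close>.
\<close>

definition log_lik_hat ::
  "('m \<Rightarrow> 's \<Rightarrow> 'd \<Rightarrow> ennreal) \<Rightarrow> ('m \<times> 'w \<Rightarrow> 's pmf) \<Rightarrow> 's pmf \<Rightarrow> 'd \<Rightarrow> 'm \<times> 'w \<Rightarrow> ereal" where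
  "log_lik_hat lik latent qS y \<theta> =
     eintegral (count_space UNIV)
       (\<lambda>s. ereal (pmf qS s) * eln (complete_density lik latent \<theta> s y / ennreal (pmf qS s)))"

definition Delta_J ::
  "('m \<times> 'w) measure \<Rightarrow> ('m \<Rightarrow> 's \<Rightarrow> 'd \<Rightarrow> ennreal) \<Rightarrow> ('m \<times> 'w \<Rightarrow> 's pmf) \<Rightarrow> 'd \<Rightarrow>
     ('m \<times> 'w \<Rightarrow> ennreal) \<Rightarrow> 's pmf \<Rightarrow> ereal" where
  "Delta_J T lik latent y q qS =
     eintegral T (\<lambda>\<theta>. (log_lik lik latent y \<theta> - log_lik_hat lik latent qS y \<theta>) * enn2ereal (q \<theta>))"

text \<open>
  If the first integral and the Kullback--Leibler term are infinite with opposite signs, the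
  \<^typ>\<open>ereal\<close> convention makes the objective \<open>\<infinity>\<close>, so that such a pair is not preferred
  to one with finite objective.
\<close>

definition Psi ::
  "real \<Rightarrow> ('m \<times> 'w) measure \<Rightarrow> ('m \<Rightarrow> 's \<Rightarrow> 'd \<Rightarrow> ennreal) \<Rightarrow> ('m \<times> 'w \<Rightarrow> 's pmf) \<Rightarrow>
     ('m \<times> 'w \<Rightarrow> ennreal) \<Rightarrow> 'm \<times> 'w \<Rightarrow> 'd \<Rightarrow> ('m \<times> 'w \<Rightarrow> ennreal) \<Rightarrow> 's pmf \<Rightarrow> ereal" where
  "Psi \<alpha> T lik latent prior \<theta>0 y q qS =
     - eintegral T (\<lambda>\<theta>. (log_lik lik latent y \<theta> - log_lik lik latent y \<theta>0) * enn2ereal (q \<theta>))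
     + Delta_J T lik latent y q qS
     + ereal (1 / \<alpha>) * KL_div T q prior"

end

theory Submission
  imports Defs
begin

text \<open>
  For fixed \<open>\<theta>\<close>, the ratio \<open>(p_\<theta> / p_\<theta>*)^\<alpha>\<close> normalised by its \<open>\<P>_\<theta>*\<close>-mean
  \<open>exp (- (1 - \<alpha>) D_\<alpha>)\<close> has mean at most 1.  Averaging over the prior (Fubini) and applying Markov's
  inequality, its prior average is at most \<open>1 / \<zeta>\<close> with probability at least \<open>1 - \<zeta>\<close>.  On that
  event the change-of-measure inequality (Donsker--Varadhan), applied to the logarithm
  \<open>\<alpha> l(\<theta>, \<theta>*) + (1 - \<alpha>) D_\<alpha>\<close> of the normalised ratio, bounds \<open>(1 - \<alpha>) \<integral> D_\<alpha> q\<close> by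
  \<open>- \<alpha> \<integral> l q + KL (q, prior) + log (1 / \<zeta>)\<close> for every density \<open>q\<close>, in particular for the minimiser.
  Jensen's inequality gives \<open>\<Delta>_J \<ge> 0\<close>, so this is at most \<open>\<alpha> \<Psi> + log (1 / \<zeta>)\<close>.
\<close>

section \<open>Extended logarithm and extended integral\<close>

lemma eln_simps [simp]:
  "eln 0 = -\<infinity>" "eln \<infinity> = \<infinity>" "eln top = \<infinity>" "0 < r \<Longrightarrow> eln (ennreal r) = ereal (ln r)"
  by (auto simp: eln_def ennreal_eq_0_iff infinity_ennreal_def)

lemma borel_measurable_eln [measurable]: "eln \<in> borel_measurable borel"
  unfolding eln_def by measurable

lemma eintegral_mono:
  assumes "\<And>x. x \<in> space M \<Longrightarrow> f x \<le> g x"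
  shows "eintegral M f \<le> eintegral M g"
  unfolding eintegral_def
  by (intro ereal_minus_mono iffD1[OF less_eq_ennreal.rep_eq] nn_integral_mono e2ennreal_mono)
     (simp_all add: assms)

lemma eintegral_ereal:
  assumes "integrable M f"
  shows "eintegral M (\<lambda>x. ereal (f x)) = ereal (integral\<^sup>L M f)"
proof -
  have fin: "(\<integral>\<^sup>+x. ennreal (f x) \<partial>M) < \<infinity>" "(\<integral>\<^sup>+x. ennreal (- f x) \<partial>M) < \<infinity>"
    using assms by (auto simp: real_integrable_def less_top)
  obtain a b where "(\<integral>\<^sup>+x. ennreal (f x) \<partial>M) = ennreal a" "(\<integral>\<^sup>+x. ennreal (- f x) \<partial>M) = ennreal b"
    "0 \<le> a" "0 \<le> b"
    using fin by (metis ennreal_cases infinity_ennreal_def less_irrefl)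
  then show ?thesis
    using real_lebesgue_integral_def[OF assms] by (simp add: eintegral_def enn2ereal_ennreal)
qed

lemma eintegral_nonneg_eq:
  assumes "\<And>x. x \<in> space M \<Longrightarrow> 0 \<le> f x"
  shows "eintegral M f = enn2ereal (\<integral>\<^sup>+ x. e2ennreal (f x) \<partial>M)"
proof -
  have "(\<integral>\<^sup>+ x. e2ennreal (- f x) \<partial>M) = (\<integral>\<^sup>+ x. 0 \<partial>M)"
    by (intro nn_integral_cong e2ennreal_neg) (simp add: assms)
  then show ?thesis
    by (simp add: eintegral_def zero_ennreal.rep_eq)
qed

lemma eintegral_nonneg:
  assumes "\<And>x. x \<in> space M \<Longrightarrow> 0 \<le> f x"
  shows "0 \<le> eintegral M f"
  by (simp add: eintegral_nonneg_eq[OF assms])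

lemma e2ennreal_cmult:
  assumes "0 < c"
  shows "e2ennreal (ereal c * x) = ennreal c * e2ennreal x"
  using assms
  by (cases x) (auto simp: ennreal_mult'[symmetric] ennreal_mult_top e2ennreal_neg)

text \<open>For negative \<open>x\<close> both sides are 0, since \<open>e2ennreal\<close>
  truncates. This lets the positive and the negative part of a log-likelihood be integrated
  separately against a density.\<close>

lemma e2ennreal_mult_enn2ereal: "e2ennreal (x * enn2ereal q) = e2ennreal x * q"
proof (cases "0 \<le> x")
  case True
  have "x = enn2ereal (e2ennreal x)"
    by (simp add: True enn2ereal_e2ennreal)
  then show ?thesis
    by (metis e2ennreal_enn2ereal times_ennreal.rep_eq)
next
  case False
  then have "x * enn2ereal q \<le> 0"
    by (simp add: ereal_mult_le_0_iff)
  with False show ?thesis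
    by (simp add: e2ennreal_neg)
qed

text \<open>Positive scaling acts on both parts alike and preserves the convention \<infinity> -
  \<infinity> = \<infinity>, so integrability is not at issue.\<close>

lemma eintegral_cmult:
  assumes [measurable]: "f \<in> borel_measurable M" and c: "0 < c"
  shows "eintegral M (\<lambda>x. ereal c * f x) = ereal c * eintegral M f"
proof -
  have neg: "- (ereal c * f x) = ereal c * - f x" for x
    by simp
  have c': "enn2ereal (ennreal c) = ereal c"
    using c by (simp add: enn2ereal_ennreal)
  show ?thesis
    unfolding eintegral_def neg e2ennreal_cmult[OF c]
    by (subst (1 2) nn_integral_cmult)
       (use c in \<open>simp_all add: times_ennreal.rep_eq c' ereal_pos_distrib minus_ereal_def\<close>)
qed

section \<open>Change of measure\<close>

text \<open>The tangent bound 1 + x \<le> exp x at x = \<open>t - ln (b / a)\<close>, scaled by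
  \<open>b\<close>. It is the pointwise Fenchel-Young inequality for relative entropy, the source of
  both the change of measure and Jensen's inequality below.\<close>

lemma young_log_exp:
  fixes a b t :: real
  assumes "0 < a" "0 < b"
  shows "b * t \<le> b * ln (b / a) - b + a * exp t"
proof -
  have "b * (1 + (t - ln (b / a))) \<le> b * exp (t - ln (b / a))"
    using assms by (intro mult_left_mono exp_ge_add_one_self) auto
  also have "\<dots> = a * exp t"
    using assms by (simp add: exp_diff)
  finally show ?thesis
    by (simp add: algebra_simps)
qed

text \<open>
  \<open>L\<close> may be \<open>-\<infinity>\<close> while \<open>D\<close> is \<open>\<infinity>\<close>, so positive and negative parts are kept on separate
  sides and no difference of infinities occurs.  The second bound shows that the positive part of
  \<open>L\<close> is integrable against \<open>q\<close> whenever the relative entropy is finite.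
\<close>

lemma change_of_measure_pointwise:
  fixes p q G D :: ennreal and L :: ereal and c :: real
  assumes rel: "G = \<infinity> \<or> L = -\<infinity> \<or>
      (\<exists>l d. 0 \<le> d \<and> L = ereal l \<and> D = ennreal d \<and> G = ennreal (exp (l + d)))"
    and c: "0 \<le> c" and fin: "p \<noteq> \<infinity>" "q \<noteq> \<infinity>"
  defines "k \<equiv> enn2ereal q * eln (q / p)"
  shows "D * q + e2ennreal L * q + q + e2ennreal (- k)
      \<le> e2ennreal (- L) * q + e2ennreal k + ennreal (exp (- c)) * (p * G) + ennreal c * q"
    and "e2ennreal L * q + e2ennreal (- k) \<le> e2ennreal k + p + p * G"
proof -
  obtain a b where ab: "p = ennreal a" "q = ennreal b" "0 \<le> a" "0 \<le> b"
    using fin by (metis ennreal_cases infinity_ennreal_def)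
  \<comment> \<open>If \<open>b = 0\<close>, \<open>k\<close> and all terms in \<open>q\<close>
    vanish. In the second case \<open>k\<close> is infinite, in the third \<open>p * G\<close>, so
    both right sides are infinite. If \<open>L\<close> is -\<infinity>, the term in
    \<open>- L\<close> settles the first bound only. The last case is real arithmetic.\<close>
  consider "b = 0" | "0 < b" "a = 0" | "0 < b" "0 < a" "G = \<infinity>" | "0 < b" "0 < a" "L = -\<infinity>"
    | l d where "0 < b" "0 < a" "0 \<le> d" "L = ereal l" "D = ennreal d" "G = ennreal (exp (l + d))"
    using rel ab by fastforce
  then have "D * q + e2ennreal L * q + q + e2ennreal (- k)
      \<le> e2ennreal (- L) * q + e2ennreal k + ennreal (exp (- c)) * (p * G) + ennreal c * q
    \<and> e2ennreal L * q + e2ennreal (- k) \<le> e2ennreal k + p + p * G"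
  proof cases
    case 1
    then show ?thesis by (simp add: k_def ab zero_ennreal.rep_eq)
  next
    case 2
    then have "k = \<infinity>" by (simp add: k_def ab ennreal_divide_zero enn2ereal_ennreal)
    then show ?thesis by simp
  next
    case 3
    then show ?thesis by (simp add: ab ennreal_mult_top)
  next
    case 4
    have k: "k = ereal (b * ln (b / a))"
      using 4 by (simp add: k_def ab divide_ennreal enn2ereal_ennreal)
    \<comment> \<open>As \<open>e2ennreal L = 0\<close> here, the second bound only asks that
      \<open>p\<close> dominate the negative part of \<open>k\<close>.\<close>
    have "- (b * ln (b / a)) \<le> a"
      using young_log_exp[of a b 0] 4 by simp
    then have "ennreal (- (b * ln (b / a))) \<le> p"
      by (simp add: ab ennreal_leI)
    then have "e2ennreal (- k) \<le> e2ennreal k + p + p * G"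
      by (simp add: k add_increasing2 add_increasing)
    then show ?thesis
      using 4 by (simp add: ab ennreal_top_mult e2ennreal_neg)
  next
    case 5
    define K where "K = b * ln (b / a)"
    have k: "k = ereal K"
      using 5 by (simp add: k_def ab divide_ennreal enn2ereal_ennreal K_def)
    \<comment> \<open>Making the truncation at 0 explicit turns both bounds into inequalities
      between nonnegative reals.\<close>
    have max0: "ennreal x = ennreal (max 0 x)" for x
      by (simp add: max_def ennreal_neg)
    \<comment> \<open>The shift by \<open>c\<close> produces the factor \<open>exp (- c)\<close>,
      which normalises the integral of \<open>p * G\<close> to at most 1.\<close>
    have "b * (l + d - c) \<le> K - b + a * exp (l + d - c)"
      using young_log_exp[of a b "l + d - c"] 5 by (simp add: K_def)
    then have *: "b * d + b * l + b \<le> K + a * (exp (- c) * exp (l + d)) + b * c"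
      by (simp add: algebra_simps exp_diff exp_minus divide_inverse)
    \<comment> \<open>The first inequality serves \<open>l \<ge> 0\<close>; the second, with
      exponent 0, controls the negative part of \<open>K\<close> when \<open>l < 0\<close>.\<close>
    have **: "b * d + b * l \<le> K - b + a * exp (l + d)" "0 \<le> K - b + a"
      using young_log_exp[of a b "l + d"] young_log_exp[of a b 0] 5
      by (simp_all add: K_def algebra_simps)
    have nonneg: "0 \<le> b * d" "0 \<le> b * c" "0 \<le> a * exp (l + d)" "0 \<le> a * (exp (- c) * exp (l + d))"
      using 5 c by auto
    have pos: "ennreal x * ennreal b = ennreal (max 0 (x * b))" for x
    proof (cases "0 \<le> x")
      case True
      then show ?thesis using 5 by (simp add: ennreal_mult)
    next
      case False
      then have "x * b \<le> 0" using 5 by (simp add: mult_nonpos_nonneg)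
      with False show ?thesis by (simp add: ennreal_neg max_absorb1)
    qed
    have e: "D * q = ennreal (d * b)" "e2ennreal L * q = ennreal (max 0 (l * b))"
      "e2ennreal (- L) * q = ennreal (max 0 (- l * b))"
      "e2ennreal k = ennreal (max 0 K)" "e2ennreal (- k) = ennreal (max 0 (- K))"
      "p * G = ennreal (a * exp (l + d))" "ennreal c * q = ennreal (c * b)"
      "ennreal (exp (- c)) * ennreal (a * exp (l + d)) = ennreal (exp (- c) * (a * exp (l + d)))"
      using 5 c pos[of l] pos[of "- l"] max0[of K] max0[of "- K"]
      by (simp_all add: ab k ennreal_mult)
    have "D * q + e2ennreal L * q + q + e2ennreal (- k)
        = ennreal (d * b + max 0 (l * b) + b + max 0 (- K))"
      unfolding e using 5 by (simp add: ab ennreal_plus)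
    also have "\<dots> \<le> ennreal (max 0 (- l * b) + max 0 K + exp (- c) * (a * exp (l + d)) + c * b)"
      using * nonneg by (intro ennreal_leI) (auto simp: max_def algebra_simps)
    also have "\<dots> = e2ennreal (- L) * q + e2ennreal k + ennreal (exp (- c)) * (p * G) + ennreal c * q"
      unfolding e using 5 c by (simp add: ennreal_plus)
    finally have 1: "D * q + e2ennreal L * q + q + e2ennreal (- k)
      \<le> e2ennreal (- L) * q + e2ennreal k + ennreal (exp (- c)) * (p * G) + ennreal c * q" .
    have "e2ennreal L * q + e2ennreal (- k) = ennreal (max 0 (l * b) + max 0 (- K))"
      unfolding e by (simp add: ennreal_plus)
    also have "\<dots> \<le> ennreal (max 0 K + a + a * exp (l + d))"
      using ** nonneg \<open>0 < a\<close> \<open>0 < b\<close> unfolding mult.commute[of l b]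
      by (intro ennreal_leI) linarith
    also have "\<dots> = e2ennreal k + p + p * G"
      unfolding e using 5 by (simp add: ab ennreal_plus)
    finally show ?thesis
      using 1 by blast
  qed
  then show "D * q + e2ennreal L * q + q + e2ennreal (- k)
      \<le> e2ennreal (- L) * q + e2ennreal k + ennreal (exp (- c)) * (p * G) + ennreal c * q"
    and "e2ennreal L * q + e2ennreal (- k) \<le> e2ennreal k + p + p * G"
    by auto
qed

text \<open>A Donsker-Varadhan inequality for the exponent \<open>L + D\<close>, whose exponential
  is \<open>G\<close> outside the degenerate cases. On integrating the pointwise bound, the mass 1
  of \<open>q\<close> on the left cancels against \<open>exp (- c)\<close> times the integral of
  \<open>p * G\<close> on the right, which is at most 1.\<close>

lemma change_of_measure:
  assumes p: "prob_density M p" and q: "prob_density M q"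
    and [measurable]: "L \<in> borel_measurable M" "D \<in> borel_measurable M" "G \<in> borel_measurable M"
    and rel: "\<And>x. x \<in> space M \<Longrightarrow> G x = \<infinity> \<or> L x = -\<infinity> \<or>
      (\<exists>l d. 0 \<le> d \<and> L x = ereal l \<and> D x = ennreal d \<and> G x = ennreal (exp (l + d)))"
    and c: "0 \<le> c" and int: "(\<integral>\<^sup>+x. p x * G x \<partial>M) \<le> ennreal (exp c)"
  shows "enn2ereal (\<integral>\<^sup>+x. D x * q x \<partial>M)
    \<le> - eintegral M (\<lambda>x. L x * enn2ereal (q x)) + KL_div M q p + ereal c"
proof (cases "KL_div M q p = \<infinity>")
  case True
  then show ?thesis by simp
next
  case False
  have [measurable]: "p \<in> borel_measurable M" "q \<in> borel_measurable M"
    and int1: "(\<integral>\<^sup>+x. p x \<partial>M) = 1" "(\<integral>\<^sup>+x. q x \<partial>M) = 1"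
    using p q by (auto simp: prob_density_def)
  have fin: "AE x in M. p x \<noteq> \<infinity>" "AE x in M. q x \<noteq> \<infinity>"
    by (rule nn_integral_noteq_infinite; simp add: int1)+
  define k where "k x = enn2ereal (q x) * eln (q x / p x)" for x
  have [measurable]: "k \<in> borel_measurable M"
    unfolding k_def by measurable
  define a b m where "a = (\<integral>\<^sup>+x. D x * q x \<partial>M)"
    and "b = (\<integral>\<^sup>+x. e2ennreal (L x) * q x \<partial>M)"
    and "m = (\<integral>\<^sup>+x. e2ennreal (- L x) * q x \<partial>M)"
  define kp kn Z where "kp = (\<integral>\<^sup>+x. e2ennreal (k x) \<partial>M)"
    and "kn = (\<integral>\<^sup>+x. e2ennreal (- k x) \<partial>M)"
    and "Z = (\<integral>\<^sup>+x. p x * G x \<partial>M)"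
  have KL: "KL_div M q p = enn2ereal kp - enn2ereal kn"
    unfolding KL_div_def eintegral_def kp_def kn_def k_def ..
  have IL: "eintegral M (\<lambda>x. L x * enn2ereal (q x)) = enn2ereal b - enn2ereal m"
    unfolding eintegral_def b_def m_def ereal_mult_minus_left[symmetric] e2ennreal_mult_enn2ereal ..
  have "a + b + 1 + kn = (\<integral>\<^sup>+x. D x * q x + e2ennreal (L x) * q x + q x + e2ennreal (- k x) \<partial>M)"
    by (simp add: nn_integral_add a_def b_def kn_def int1)
  also have "\<dots> \<le> (\<integral>\<^sup>+x. e2ennreal (- L x) * q x + e2ennreal (k x)
      + ennreal (exp (- c)) * (p x * G x) + ennreal c * q x \<partial>M)"
    using fin AE_space unfolding k_def
    by (intro nn_integral_mono_AE, eventually_elim)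
       (rule change_of_measure_pointwise(1)[OF rel c])
  also have "\<dots> = m + kp + ennreal (exp (- c)) * Z + ennreal c"
    by (simp add: nn_integral_add nn_integral_cmult m_def kp_def Z_def int1)
  also have "ennreal (exp (- c)) * Z \<le> ennreal (exp (- c)) * ennreal (exp c)"
    unfolding Z_def by (intro mult_left_mono int) simp
  also have "\<dots> = 1"
    by (simp add: ennreal_mult[symmetric] exp_minus)
  finally have 1: "a + b + 1 + kn \<le> m + kp + 1 + ennreal c"
    by (simp add: add_mono)
  have "b + kn = (\<integral>\<^sup>+x. e2ennreal (L x) * q x + e2ennreal (- k x) \<partial>M)"
    by (simp add: nn_integral_add b_def kn_def)
  also have "\<dots> \<le> (\<integral>\<^sup>+x. e2ennreal (k x) + p x + p x * G x \<partial>M)"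
    using fin AE_space unfolding k_def
    by (intro nn_integral_mono_AE, eventually_elim)
       (rule change_of_measure_pointwise(2)[OF rel c])
  also have "\<dots> = kp + 1 + Z"
    by (simp add: nn_integral_add kp_def Z_def int1)
  finally have 2: "b + kn \<le> kp + 1 + Z" .
  \<comment> \<open>By \<infinity> - \<infinity> = \<infinity>, an infinite \<open>kp\<close> would
    force an infinite divergence whatever \<open>kn\<close> is.\<close>
  have kp: "kp < \<infinity>"
    using False KL by (cases "kp = \<infinity>") (auto simp: less_top)
  moreover have "Z < \<infinity>"
    using int unfolding Z_def by (simp add: le_less_trans)
  ultimately have bkn: "b + kn < \<infinity>"
    by (intro le_less_trans[OF 2]) simp
  show ?thesis
  \<comment> \<open>Finiteness of \<open>b\<close> matters here: it makes the integral of
    \<open>L\<close> equal to -\<infinity>, so the right side is \<infinity>. With \<open>b\<close>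
    infinite as well, the convention would give the opposite sign.\<close>
  proof (cases "m = \<infinity>")
    case True
    then show ?thesis
      using bkn kp by (cases b; cases kp; cases kn) (simp_all add: KL IL enn2ereal_ennreal a_def)
  next
    case False
    have "a + b + 1 + kn < \<infinity>"
      using False kp by (intro le_less_trans[OF 1]) (simp add: less_top)
    then have "a < \<infinity>"
      by simp
    with bkn kp False obtain a' b' m' kp' kn' where eq:
      "a = ennreal a'" "b = ennreal b'" "m = ennreal m'" "kp = ennreal kp'" "kn = ennreal kn'"
      "0 \<le> a'" "0 \<le> b'" "0 \<le> m'" "0 \<le> kp'" "0 \<le> kn'"
      by (cases a; cases b; cases m; cases kp; cases kn) auto
    have "ennreal (a' + b' + 1 + kn') \<le> ennreal (m' + kp' + 1 + c)"
      using 1 c eq by simp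
    then have "a' + b' + 1 + kn' \<le> m' + kp' + 1 + c"
      using eq c by (subst (asm) ennreal_le_iff) auto
    then show ?thesis
      using eq by (simp add: KL IL a_def[symmetric] enn2ereal_ennreal)
  qed
qed

section \<open>Jensen's inequality for the latent variable\<close>

lemma ennreal_pos_cases [case_names infinity zero pos]:
  obtains "x = \<infinity>" | "x = 0" | z where "x = ennreal z" "0 < z"
proof (cases x)
  case (real r)
  then show ?thesis using that by (cases "r = 0") auto
next
  case top
  then show ?thesis using that by simp
qed

lemma ennreal_finiteE:
  assumes "x \<noteq> \<infinity>"
  obtains r where "x = ennreal r" "0 \<le> r"
  using assms by (cases x) auto

text \<open>With z the total of \<open>a\<close>, the tangent bound gives q log (a/q) \<le> q log z
  + a/z - q for each \<open>s\<close>. Summing over \<open>s\<close>, the last two terms cancel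
  because a/z and q both have total 1.\<close>

lemma jensen_log_sum:
  fixes q :: "'s pmf" and a :: "'s \<Rightarrow> ennreal"
  shows "eintegral (count_space UNIV) (\<lambda>s. ereal (pmf q s) * eln (a s / ennreal (pmf q s)))
    \<le> eln (\<integral>\<^sup>+ s. a s \<partial>count_space UNIV)" (is "eintegral ?C ?f \<le> eln ?Z")
proof -
  have a_le: "a s \<le> ?Z" for s
    by (rule nn_integral_ge_point) simp
  consider "?Z = \<infinity>" | "?Z = 0" | z where "?Z = ennreal z" "0 < z"
    by (rule ennreal_pos_cases)
  then show ?thesis
  proof cases
    case 1
    then show ?thesis by simp
  next
    case 2
    then have a0: "a s = 0" for s
      using a_le[of s] by simp
    \<comment> \<open>Every term with positive weight is -\<infinity>. A bound by each real
      \<open>t\<close> yields -\<infinity> without choosing an atom of \<open>q\<close>.\<close>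
    have "eintegral ?C ?f \<le> ereal t" for t
    proof -
      have "?f s \<le> ereal (t * pmf q s)" for s
        by (cases "pmf q s = 0") (simp_all add: a0 order_le_less)
      then have "eintegral ?C ?f \<le> eintegral ?C (\<lambda>s. ereal (t * pmf q s))"
        by (intro eintegral_mono) simp
      also have "\<dots> = ereal t"
        by (subst eintegral_ereal) (simp_all add: integrable_pmf integral_pmf)
      finally show ?thesis .
    qed
    then show ?thesis
      using 2 by (simp add: ereal_bot)
  next
    case 3
    have fin: "a s = ennreal (enn2real (a s))" for s
      using a_le[of s] 3 by (cases "a s") (auto simp: top_unique)
    have "(\<integral>\<^sup>+ s. ennreal (enn2real (a s)) \<partial>?C) = ennreal z"
      using 3 by (simp flip: fin)
    then have int: "integrable ?C (\<lambda>s. enn2real (a s))" "integral\<^sup>L ?C (\<lambda>s. enn2real (a s)) = z"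
      using 3 by (auto intro!: integrableI_nn_integral_finite integral_eq_nn_integral[THEN trans])
    have "?f s \<le> ereal (ln z * pmf q s + enn2real (a s) / z - pmf q s)" for s
    proof -
      define b c where "b = pmf q s" and "c = enn2real (a s)"
      have bc: "0 \<le> b" "0 \<le> c" "a s = ennreal c"
        using fin by (auto simp: b_def c_def)
      consider "b = 0" | "0 < b" "c = 0" | "0 < b" "0 < c"
        using bc by fastforce
      then have "ereal b * eln (a s / ennreal b) \<le> ereal (ln z * b + c / z - b)"
      proof cases
        case 1
        then show ?thesis using bc \<open>0 < z\<close> by (simp add: zero_ereal_def[symmetric])
      next
        case 2
        then show ?thesis by (simp add: bc)
      next
        case 3
        with young_log_exp[of "c / z" b 0] \<open>0 < z\<close> show ?thesis
          by (simp add: bc divide_ennreal ln_div ln_mult algebra_simps)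
      qed
      then show ?thesis by (simp add: b_def c_def)
    qed
    then have "eintegral ?C ?f
        \<le> eintegral ?C (\<lambda>s. ereal (ln z * pmf q s + enn2real (a s) / z - pmf q s))"
      by (intro eintegral_mono) simp
    also have "\<dots> = ereal (ln z)"
      using 3 by (subst eintegral_ereal) (simp_all add: int integrable_pmf integral_pmf)
    finally show ?thesis
      using 3 by simp
  qed
qed

section \<open>Affinity and likelihood ratios\<close>

lemma prob_density_AE_finite:
  assumes "prob_density M p"
  shows "AE x in M. p x \<noteq> \<infinity>"
  using assms by (intro nn_integral_noteq_infinite) (auto simp: prob_density_def)

lemma prob_space_density:
  assumes "prob_density M p"
  shows "prob_space (density M p)"
  using assms by (intro prob_spaceI)
    (simp add: prob_density_def emeasure_density nn_integral_set_ennreal cong: nn_integral_cong)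

text \<open>The Hellinger integral of order \<alpha>, that is exp (-(1 - \<alpha>) D) for the Renyi
  divergence D. It is named because it serves as the normalising divisor.\<close>

definition affinity :: "real \<Rightarrow> 'a measure \<Rightarrow> ('a \<Rightarrow> ennreal) \<Rightarrow> ('a \<Rightarrow> ennreal) \<Rightarrow> ennreal" where
  "affinity \<alpha> M p q = (\<integral>\<^sup>+ x. ennreal (enn2real (p x) powr \<alpha> * enn2real (q x) powr (1 - \<alpha>)) \<partial>M)"

text \<open>The case split is needed because \<open>enn2real \<infinity> = 0\<close>.\<close>

definition ratio_powr :: "real \<Rightarrow> ennreal \<Rightarrow> ennreal \<Rightarrow> ennreal" where
  "ratio_powr \<alpha> u v = (if u = \<infinity> then \<infinity> else ennreal ((enn2real u / enn2real v) powr \<alpha>))"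

lemma borel_measurable_ratio_powr [measurable (raw)]:
  assumes [measurable]: "f \<in> borel_measurable M" "g \<in> borel_measurable M"
  shows "(\<lambda>x. ratio_powr \<alpha> (f x) (g x)) \<in> borel_measurable M"
  unfolding ratio_powr_def by measurable

text \<open>Weighted arithmetic-geometric mean inequality, integrated. It makes the Renyi divergence
  nonnegative, as the role of \<open>D\<close> in \<open>change_of_measure\<close> requires.\<close>

lemma affinity_le_1:
  assumes p: "prob_density M p" and q: "prob_density M q" and \<alpha>: "0 < \<alpha>" "\<alpha> < 1"
  shows "affinity \<alpha> M p q \<le> 1"
proof -
  have [measurable]: "p \<in> borel_measurable M" "q \<in> borel_measurable M"
    and int1: "(\<integral>\<^sup>+x. p x \<partial>M) = 1" "(\<integral>\<^sup>+x. q x \<partial>M) = 1"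
    using p q by (auto simp: prob_density_def)
  have le: "ennreal (enn2real u powr \<alpha> * enn2real v powr (1 - \<alpha>)) \<le> ennreal \<alpha> * u + ennreal (1 - \<alpha>) * v"
    if fin: "u \<noteq> \<infinity>" "v \<noteq> \<infinity>" for u v
  proof -
    obtain a b where ab: "u = ennreal a" "v = ennreal b" "0 \<le> a" "0 \<le> b"
      by (rule ennreal_finiteE[OF fin(1)], rule ennreal_finiteE[OF fin(2)])
    have "a powr \<alpha> * b powr (1 - \<alpha>) \<le> \<alpha> * a + (1 - \<alpha>) * b"
      using ab \<alpha> Youngs_inequality_0[of \<alpha> "1 - \<alpha>" a b] by (cases "a = 0 \<or> b = 0") auto
    then have "ennreal (a powr \<alpha> * b powr (1 - \<alpha>)) \<le> ennreal (\<alpha> * a + (1 - \<alpha>) * b)"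
      by (rule ennreal_leI)
    then show ?thesis
      using ab \<alpha> by (simp add: ennreal_plus ennreal_mult)
  qed
  have "affinity \<alpha> M p q \<le> (\<integral>\<^sup>+x. ennreal \<alpha> * p x + ennreal (1 - \<alpha>) * q x \<partial>M)"
    unfolding affinity_def using prob_density_AE_finite[OF p] prob_density_AE_finite[OF q]
    by (intro nn_integral_mono_AE, eventually_elim) (rule le)
  also have "\<dots> = ennreal \<alpha> + ennreal (1 - \<alpha>)"
    by (simp add: nn_integral_add nn_integral_cmult int1)
  also have "\<dots> = 1"
    using \<alpha> by (simp flip: ennreal_plus)
  finally show ?thesis .
qed

text \<open>Pointwise v (u/v)^\<alpha> = u^\<alpha> v^(1 - \<alpha>) for finite values; at v = 0
  both sides are 0.\<close>

lemma nn_integral_ratio_powr: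
  assumes p: "prob_density M p" and q: "prob_density M q" and \<alpha>: "0 < \<alpha>" "\<alpha> < 1"
  shows "(\<integral>\<^sup>+x. ratio_powr \<alpha> (p x) (q x) \<partial>density M q) = affinity \<alpha> M p q"
proof -
  have [measurable]: "p \<in> borel_measurable M" "q \<in> borel_measurable M"
    using p q by (auto simp: prob_density_def)
  have eq: "v * ratio_powr \<alpha> u v = ennreal (enn2real u powr \<alpha> * enn2real v powr (1 - \<alpha>))"
    if fin: "u \<noteq> \<infinity>" "v \<noteq> \<infinity>" for u v
  proof -
    obtain a b where ab: "u = ennreal a" "v = ennreal b" "0 \<le> a" "0 \<le> b"
      by (rule ennreal_finiteE[OF fin(1)], rule ennreal_finiteE[OF fin(2)])
    have "b * (a / b) powr \<alpha> = a powr \<alpha> * b powr (1 - \<alpha>)"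
      using ab by (cases "b = 0") (simp_all add: powr_divide powr_diff)
    then show ?thesis
      using ab by (simp add: ratio_powr_def flip: ennreal_mult)
  qed
  show ?thesis
    unfolding affinity_def using prob_density_AE_finite[OF p] prob_density_AE_finite[OF q]
    by (subst nn_integral_density) (auto intro!: nn_integral_cong_AE simp: eq)
qed

lemma Renyi_div_affinity: "Renyi_div \<alpha> M p q = ereal (1 / (\<alpha> - 1)) * eln (affinity \<alpha> M p q)"
  unfolding Renyi_div_def affinity_def ..

lemma eln_nonpos: "x \<le> 1 \<Longrightarrow> eln x \<le> 0"
  by (cases x) (auto simp: eln_def zero_ereal_def top_unique)

lemma Renyi_div_nonneg:
  assumes "prob_density M p" "prob_density M q" "0 < \<alpha>" "\<alpha> < 1"
  shows "0 \<le> Renyi_div \<alpha> M p q"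
  using eln_nonpos[OF affinity_le_1[OF assms]] assms
  by (simp add: Renyi_div_affinity ereal_zero_le_0_iff)

text \<open>Provides the hypothesis \<open>rel\<close> of \<open>change_of_measure\<close>, with
  \<open>u\<close> and \<open>v\<close> the two likelihoods and \<open>r\<close> the affinity. Since
  (1 - \<alpha>)/(\<alpha> - 1) = -1, \<open>D\<close> is \<open>- ln r\<close>, nonnegative by
  \<open>r \<le> 1\<close>. For positive finite \<open>u\<close>, mutual singularity
  (\<open>r = 0\<close>) makes \<open>G\<close> infinite.\<close>

lemma likelihood_ratio_cases:
  fixes r u v :: ennreal and \<alpha> :: real
  assumes r: "r \<le> 1" and v: "0 < v" "v < \<infinity>" and \<alpha>: "0 < \<alpha>" "\<alpha> < 1"
  defines "L \<equiv> ereal \<alpha> * (eln u - eln v)" and "G \<equiv> ratio_powr \<alpha> u v / r"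
    and "D \<equiv> e2ennreal (ereal (1 - \<alpha>) * (ereal (1 / (\<alpha> - 1)) * eln r))"
  shows "G = \<infinity> \<or> L = -\<infinity> \<or>
      (\<exists>l d. 0 \<le> d \<and> L = ereal l \<and> D = ennreal d \<and> G = ennreal (exp (l + d)))"
proof -
  obtain b where b: "v = ennreal b" "0 < b"
    using v by (metis ennreal_cases ennreal_less_zero_iff infinity_ennreal_def less_irrefl)
  obtain c where c: "r = ennreal c" "0 \<le> c" "c \<le> 1"
    using r by (cases r) (auto simp: top_unique)
  consider "u = \<infinity>" | "u = 0" | a where "u = ennreal a" "0 < a"
    by (rule ennreal_pos_cases)
  then show ?thesis
  proof cases
    case 1
    then show ?thesis by (simp add: G_def ratio_powr_def c ennreal_top_divide)
  next
    case 2
    then show ?thesis using \<alpha> by (simp add: L_def b)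
  next
    case 3
    show ?thesis
    proof (cases "c = 0")
      case True
      with 3 b show ?thesis
        by (simp add: G_def c ratio_powr_def ennreal_divide_zero)
    next
      case False
      with c have c0: "0 < c" by simp
      have "L = ereal (\<alpha> * (ln a - ln b))"
        using 3 b by (simp add: L_def)
      moreover have "(1 - \<alpha>) * (1 / (\<alpha> - 1) * ln c) = - ln c"
        using \<alpha> by (simp add: divide_simps) (simp add: algebra_simps)
      then have "D = ennreal (- ln c)"
        using c c0 by (simp add: D_def)
      moreover have "G = ennreal (exp (\<alpha> * (ln a - ln b) + - ln c))"
        using 3 b c c0
        by (simp add: G_def ratio_powr_def divide_ennreal powr_def ln_div exp_diff)
      ultimately show ?thesis
        using c c0 by (intro disjI2 exI[of _ "\<alpha> * (ln a - ln b)"] exI[of _ "- ln c"]) auto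
    qed
  qed
qed

section \<open>The high-probability event\<close>

text \<open>Measurability of the affinity in \<theta> and the moment bound both come from the joint
  measurability of the ratio. The event also avoids the null set where \<open>p0\<close> is 0 or
  \<infinity>, so that its logarithm is finite.\<close>

lemma high_probability_event:
  fixes p :: "'a \<Rightarrow> 'd \<Rightarrow> ennreal"
  assumes pm: "case_prod p \<in> borel_measurable (T \<Otimes>\<^sub>M \<nu>)"
    and pd: "\<And>\<theta>. \<theta> \<in> space T \<Longrightarrow> prob_density \<nu> (p \<theta>)"
    and p0: "prob_density \<nu> p0" and prior: "prob_density T prior"
    and \<alpha>: "0 < \<alpha>" "\<alpha> < 1" and \<zeta>: "0 < \<zeta>" "\<zeta> < 1"
  shows "(\<lambda>\<theta>. affinity \<alpha> \<nu> (p \<theta>) p0) \<in> borel_measurable T"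
    and "\<exists>A \<in> sets \<nu>. measure (density \<nu> p0) A \<ge> 1 - \<zeta> \<and> (\<forall>y\<in>A. 0 < p0 y \<and> p0 y < \<infinity> \<and>
      (\<integral>\<^sup>+\<theta>. prior \<theta> * (ratio_powr \<alpha> (p \<theta> y) (p0 y) / affinity \<alpha> \<nu> (p \<theta>) p0) \<partial>T)
        \<le> ennreal (1 / \<zeta>))"
proof -
  define P Q where "P = density \<nu> p0" and "Q = density T prior"
  have meas [measurable]: "p0 \<in> borel_measurable \<nu>" "prior \<in> borel_measurable T"
    using p0 prior by (auto simp: prob_density_def)
  have [measurable_cong, simp]: "sets P = sets \<nu>" "sets Q = sets T"
    by (auto simp: P_def Q_def)
  have sp [simp]: "space P = space \<nu>" "space Q = space T"
    by (auto simp: P_def Q_def)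
  \<comment> \<open>Fubini is applied to these probability measures, since no sigma-finiteness is
    assumed of \<open>T\<close> and \<open>\<nu>\<close>.\<close>
  interpret P: prob_space P
    unfolding P_def by (rule prob_space_density[OF p0])
  interpret Q: prob_space Q
    unfolding Q_def by (rule prob_space_density[OF prior])
  interpret PQ: pair_sigma_finite Q P ..
  define R where "R \<theta> y = ratio_powr \<alpha> (p \<theta> y) (p0 y)" for \<theta> y
  have setsQP: "sets (Q \<Otimes>\<^sub>M P) = sets (T \<Otimes>\<^sub>M \<nu>)"
    by (intro sets_pair_measure_cong) simp_all
  have pm' [measurable]: "case_prod p \<in> borel_measurable (Q \<Otimes>\<^sub>M P)"
    using pm by (simp cong: measurable_cong_sets add: setsQP)
  have Rm [measurable]: "case_prod R \<in> borel_measurable (Q \<Otimes>\<^sub>M P)"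
    unfolding R_def split_beta' by measurable
  define \<rho> where "\<rho> \<theta> = affinity \<alpha> \<nu> (p \<theta>) p0" for \<theta>
  have \<rho>: "(\<integral>\<^sup>+y. R \<theta> y \<partial>P) = \<rho> \<theta>" if "\<theta> \<in> space T" for \<theta>
    using nn_integral_ratio_powr[OF pd[OF that] p0 \<alpha>] by (simp add: R_def P_def \<rho>_def)
  have "(\<lambda>\<theta>. \<integral>\<^sup>+y. R \<theta> y \<partial>P) \<in> borel_measurable Q"
    by measurable
  then have \<rho>Q: "\<rho> \<in> borel_measurable Q"
    by (rule measurable_cong[THEN iffD1, rotated]) (simp add: \<rho>)
  then show "(\<lambda>\<theta>. affinity \<alpha> \<nu> (p \<theta>) p0) \<in> borel_measurable T"
    by (simp add: \<rho>_def[abs_def] cong: measurable_cong_sets)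
  note \<rho>Q [measurable]
  \<comment> \<open>If \<open>\<rho> \<theta> = 0\<close> then \<open>R \<theta> y = 0\<close> for almost every \<open>y\<close>, and \<open>0 / 0 = 0\<close>.\<close>
  define Z where "Z y = (\<integral>\<^sup>+\<theta>. R \<theta> y / \<rho> \<theta> \<partial>Q)" for y
  have [measurable]: "Z \<in> borel_measurable P"
    unfolding Z_def by measurable
  have "(\<integral>\<^sup>+y. Z y \<partial>P) = (\<integral>\<^sup>+\<theta>. (\<integral>\<^sup>+y. R \<theta> y / \<rho> \<theta> \<partial>P) \<partial>Q)"
    unfolding Z_def by (rule PQ.Fubini') measurable
  also have "\<dots> \<le> (\<integral>\<^sup>+\<theta>. 1 \<partial>Q)"
  proof (rule nn_integral_mono)
    fix \<theta> assume \<theta>: "\<theta> \<in> space Q"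
    have [measurable]: "R \<theta> \<in> borel_measurable P"
      using measurable_Pair2[OF Rm \<theta>] by simp
    have "(\<integral>\<^sup>+y. R \<theta> y / \<rho> \<theta> \<partial>P) = \<rho> \<theta> / \<rho> \<theta>"
      using \<theta> by (subst nn_integral_divide) (simp_all add: \<rho>)
    also have "\<dots> \<le> 1"
      by (cases "\<rho> \<theta> = 0 \<or> \<rho> \<theta> = \<infinity>") (auto simp: ennreal_divide_self less_top)
    finally show "(\<integral>\<^sup>+y. R \<theta> y / \<rho> \<theta> \<partial>P) \<le> 1" .
  qed
  finally have EZ: "(\<integral>\<^sup>+y. Z y \<partial>P) \<le> 1"
    using Q.emeasure_space_1 by simp
  \<comment> \<open>The bad set of Markov's inequality, where \<open>Z\<close> is at least
    1/\<zeta>.\<close>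
  define B where "B = {y \<in> space P. 1 \<le> ennreal \<zeta> * Z y}"
  define A where "A = {y \<in> space P. \<not> 1 \<le> ennreal \<zeta> * Z y \<and> 0 < p0 y \<and> p0 y < \<infinity>}"
  have [measurable]: "A \<in> sets P" "B \<in> sets P"
    by (auto simp: A_def B_def)
  have "emeasure P B \<le> ennreal \<zeta> * (\<integral>\<^sup>+y. Z y * indicator (space P) y \<partial>P)"
    unfolding B_def by (rule nn_integral_Markov_inequality) auto
  also have "(\<integral>\<^sup>+y. Z y * indicator (space P) y \<partial>P) = (\<integral>\<^sup>+y. Z y \<partial>P)"
    by (intro nn_integral_cong) simp
  also have "ennreal \<zeta> * (\<integral>\<^sup>+y. Z y \<partial>P) \<le> ennreal \<zeta> * 1"
    using EZ by (intro mult_left_mono) simp_all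
  finally have "measure P B \<le> \<zeta>"
    using \<zeta> by (simp add: P.emeasure_eq_measure)
  moreover have "AE y in P. 0 < p0 y \<and> p0 y < \<infinity>"
    unfolding P_def using prob_density_AE_finite[OF p0]
    by (subst AE_density) (auto simp: less_top)
  then have "measure P A = measure P (space P - B)"
    by (intro P.finite_measure_eq_AE) (auto simp: A_def B_def)
  ultimately have "1 - \<zeta> \<le> measure P A"
    using P.prob_compl[OF \<open>B \<in> sets P\<close>] by simp
  moreover have "(\<integral>\<^sup>+\<theta>. prior \<theta> * (R \<theta> y / \<rho> \<theta>) \<partial>T) \<le> ennreal (1 / \<zeta>)" if "y \<in> A" for y
  proof -
    have y: "y \<in> space P" "ennreal \<zeta> * Z y \<le> 1"
      using that by (auto simp: A_def)
    have [measurable]: "(\<lambda>\<theta>. R \<theta> y) \<in> borel_measurable T"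
      using measurable_Pair1[OF Rm y(1)] by (simp cong: measurable_cong_sets)
    have [measurable]: "\<rho> \<in> borel_measurable T"
      using \<rho>Q by (simp cong: measurable_cong_sets)
    have "(\<integral>\<^sup>+\<theta>. prior \<theta> * (R \<theta> y / \<rho> \<theta>) \<partial>T) = Z y"
      unfolding Z_def Q_def by (subst nn_integral_density) auto
    also have "Z y = ennreal (1 / \<zeta>) * (ennreal \<zeta> * Z y)"
      using \<zeta> by (simp add: mult.assoc[symmetric] flip: ennreal_mult)
    also have "\<dots> \<le> ennreal (1 / \<zeta>)"
      using mult_left_mono[OF y(2), of "ennreal (1 / \<zeta>)"] by simp
    finally show ?thesis .
  qed
  ultimately show "\<exists>A \<in> sets \<nu>. measure (density \<nu> p0) A \<ge> 1 - \<zeta> \<and> (\<forall>y\<in>A. 0 < p0 y \<and> p0 y < \<infinity> \<and>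
      (\<integral>\<^sup>+\<theta>. prior \<theta> * (ratio_powr \<alpha> (p \<theta> y) (p0 y) / affinity \<alpha> \<nu> (p \<theta>) p0) \<partial>T)
        \<le> ennreal (1 / \<zeta>))"
    using \<open>A \<in> sets P\<close> by (intro bexI[of _ A]) (auto simp: P_def[symmetric] R_def \<rho>_def A_def)
qed

section \<open>The mixture density of the data\<close>

text \<open>Countability of the index type gives joint measurability from that of the sections, and
  makes the counting measure sigma-finite.\<close>

lemma borel_measurable_nn_integral_count_space:
  fixes f :: "'s :: countable \<Rightarrow> 'a \<Rightarrow> ennreal"
  assumes "\<And>s. f s \<in> borel_measurable M"
  shows "(\<lambda>x. \<integral>\<^sup>+s. f s x \<partial>count_space UNIV) \<in> borel_measurable M"
proof -
  have "(\<lambda>(s, x). f s x) \<in> borel_measurable (count_space UNIV \<Otimes>\<^sub>M M)"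
    using assms by (intro measurable_pair_measure_countable1) auto
  then have "(\<lambda>(x, s). f s x) \<in> borel_measurable (M \<Otimes>\<^sub>M count_space UNIV)"
    by (simp add: measurable_pair_swap_iff[of _ M])
  then show ?thesis
    by (rule sigma_finite_measure.borel_measurable_nn_integral[OF sigma_finite_measure_count_space])
qed

lemma prob_density_data_density:
  fixes lik :: "'m \<Rightarrow> 's :: countable \<Rightarrow> 'd \<Rightarrow> ennreal"
  assumes "\<And>s. prob_density \<nu> (lik (fst \<theta>) s)"
  shows "prob_density \<nu> (data_density lik latent \<theta>)"
proof -
  have lik [measurable]: "lik (fst \<theta>) s \<in> borel_measurable \<nu>" "(\<integral>\<^sup>+y. lik (fst \<theta>) s y \<partial>\<nu>) = 1" for s
    using assms by (auto simp: prob_density_def)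
  have "data_density lik latent \<theta> \<in> borel_measurable \<nu>"
    unfolding data_density_def complete_density_def
    by (intro borel_measurable_nn_integral_count_space) simp
  moreover have "(\<integral>\<^sup>+y. data_density lik latent \<theta> y \<partial>\<nu>)
      = (\<integral>\<^sup>+s. \<integral>\<^sup>+y. lik (fst \<theta>) s y * ennreal (pmf (latent \<theta>) s) \<partial>\<nu> \<partial>count_space UNIV)"
    unfolding data_density_def complete_density_def
    by (intro nn_integral_count_space_nn_integral) auto
  moreover have "\<dots> = 1"
    by (simp add: nn_integral_multc lik nn_integral_pmf)
  ultimately show ?thesis
    by (simp add: prob_density_def)
qed

lemma borel_measurable_data_density:
  fixes lik :: "'m \<Rightarrow> 's :: countable \<Rightarrow> 'd \<Rightarrow> ennreal" and T :: "('m \<times> 'w) measure"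
  assumes [measurable]: "\<And>s. (\<lambda>(\<theta>, y). lik (fst \<theta>) s y) \<in> borel_measurable (T \<Otimes>\<^sub>M \<nu>)"
    "\<And>s. (\<lambda>\<theta>. pmf (latent \<theta>) s) \<in> borel_measurable T"
  shows "case_prod (data_density lik latent) \<in> borel_measurable (T \<Otimes>\<^sub>M \<nu>)"
proof -
  have "(\<lambda>x. lik (fst (fst x)) s (snd x) * ennreal (pmf (latent (fst x)) s))
      \<in> borel_measurable (T \<Otimes>\<^sub>M \<nu>)" for s
    using assms(1)[of s] by (simp add: split_beta')
  then show ?thesis
    unfolding data_density_def complete_density_def split_beta'
    by (intro borel_measurable_nn_integral_count_space) simp
qed

section \<open>The objective bound and its minimiser\<close>

lemma Delta_J_nonneg: "0 \<le> Delta_J T lik latent y q qS"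
  unfolding Delta_J_def
proof (rule eintegral_nonneg)
  fix \<theta>
  have "log_lik_hat lik latent qS y \<theta> \<le> log_lik lik latent y \<theta>"
    unfolding log_lik_hat_def log_lik_def data_density_def by (rule jensen_log_sum)
  \<comment> \<open>If both terms are the same infinity, the difference is \<infinity> by
    convention, hence still nonnegative.\<close>
  then have "0 \<le> log_lik lik latent y \<theta> - log_lik_hat lik latent qS y \<theta>"
    by (cases "log_lik lik latent y \<theta>"; cases "log_lik_hat lik latent qS y \<theta>") auto
  then show "0 \<le> (log_lik lik latent y \<theta> - log_lik_hat lik latent qS y \<theta>) * enn2ereal (q \<theta>)"
    by simp
qed

text \<open>\<open>change_of_measure\<close> with exponent \<alpha> times the log-likelihood ratio,
  \<open>D\<close> equal to 1 - \<alpha> times the Renyi divergence and c = log (1/\<zeta>). It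
  holds for any density \<open>q\<close>; minimality enters only in the theorem.\<close>

lemma Psi_bound:
  fixes lik :: "'m \<Rightarrow> 's :: countable \<Rightarrow> 'd \<Rightarrow> ennreal" and T :: "('m \<times> 'w) measure"
    and latent :: "'m \<times> 'w \<Rightarrow> 's pmf"
  defines "p \<equiv> data_density lik latent"
  assumes pm: "case_prod p \<in> borel_measurable (T \<Otimes>\<^sub>M \<nu>)"
    and pd: "\<And>\<theta>. \<theta> \<in> space T \<Longrightarrow> prob_density \<nu> (p \<theta>)"
    and p0: "prob_density \<nu> (p \<theta>0)" and prior: "prob_density T prior" and q: "prob_density T q"
    and \<alpha>: "0 < \<alpha>" "\<alpha> < 1" and \<zeta>: "0 < \<zeta>" "\<zeta> < 1"
    and aff: "(\<lambda>\<theta>. affinity \<alpha> \<nu> (p \<theta>) (p \<theta>0)) \<in> borel_measurable T"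
    and y: "y \<in> space \<nu>" "0 < p \<theta>0 y" "p \<theta>0 y < \<infinity>"
    and Z: "(\<integral>\<^sup>+\<theta>. prior \<theta> * (ratio_powr \<alpha> (p \<theta> y) (p \<theta>0 y) / affinity \<alpha> \<nu> (p \<theta>) (p \<theta>0)) \<partial>T)
        \<le> ennreal (1 / \<zeta>)"
  shows "eintegral T (\<lambda>\<theta>. ereal (1 - \<alpha>) * Renyi_div \<alpha> \<nu> (p \<theta>) (p \<theta>0) * enn2ereal (q \<theta>))
    \<le> ereal \<alpha> * Psi \<alpha> T lik latent prior \<theta>0 y q qS + ereal (ln (1 / \<zeta>))"
proof -
  note aff [measurable]
  have [measurable]: "(\<lambda>\<theta>. p \<theta> y) \<in> borel_measurable T"
    using measurable_Pair1[OF pm y(1)] by simp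
  have [measurable]: "q \<in> borel_measurable T"
    using q by (simp add: prob_density_def)
  define L where "L \<theta> = log_lik lik latent y \<theta> - log_lik lik latent y \<theta>0" for \<theta>
  have L: "L \<theta> = eln (p \<theta> y) - eln (p \<theta>0 y)" for \<theta>
    by (simp add: L_def log_lik_def p_def)
  have [measurable]: "L \<in> borel_measurable T"
    unfolding L[abs_def] by measurable
  define D where "D \<theta> = e2ennreal (ereal (1 - \<alpha>) * Renyi_div \<alpha> \<nu> (p \<theta>) (p \<theta>0))" for \<theta>
  have [measurable]: "D \<in> borel_measurable T"
    unfolding D_def[abs_def] Renyi_div_affinity by measurable
  have "0 \<le> ln (1 / \<zeta>)" "exp (ln (1 / \<zeta>)) = 1 / \<zeta>"
    using \<zeta> by simp_all
  then have "enn2ereal (\<integral>\<^sup>+\<theta>. D \<theta> * q \<theta> \<partial>T)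
      \<le> - eintegral T (\<lambda>\<theta>. (ereal \<alpha> * L \<theta>) * enn2ereal (q \<theta>)) + KL_div T q prior + ereal (ln (1 / \<zeta>))"
    using Z likelihood_ratio_cases[OF affinity_le_1[OF pd p0 \<alpha>] y(2,3) \<alpha>]
    by (intro change_of_measure[OF prior q,
          where G = "\<lambda>\<theta>. ratio_powr \<alpha> (p \<theta> y) (p \<theta>0 y) / affinity \<alpha> \<nu> (p \<theta>) (p \<theta>0)"])
       (auto simp: L D_def Renyi_div_affinity)
  also have "(\<lambda>\<theta>. (ereal \<alpha> * L \<theta>) * enn2ereal (q \<theta>)) = (\<lambda>\<theta>. ereal \<alpha> * (L \<theta> * enn2ereal (q \<theta>)))"
    by (simp add: mult.assoc)
  also have "- eintegral T \<dots> = ereal \<alpha> * - eintegral T (\<lambda>\<theta>. L \<theta> * enn2ereal (q \<theta>))"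
    using \<alpha> by (subst eintegral_cmult) auto
  also have "\<dots> + KL_div T q prior \<le> ereal \<alpha> * Psi \<alpha> T lik latent prior \<theta>0 y q qS"
  proof -
    \<comment> \<open>The summand 0 holds the place of \<open>Delta_J\<close>, so that termwise
      monotonicity applies.\<close>
    have "\<dots> + KL_div T q prior
        = ereal \<alpha> * (- eintegral T (\<lambda>\<theta>. L \<theta> * enn2ereal (q \<theta>)) + 0 + ereal (1 / \<alpha>) * KL_div T q prior)"
      using \<alpha> by (simp add: ereal_pos_distrib mult.assoc[symmetric])
    also have "\<dots> \<le> ereal \<alpha> * Psi \<alpha> T lik latent prior \<theta>0 y q qS"
      unfolding Psi_def L_def[symmetric] using \<alpha>
      by (intro ereal_mult_left_mono add_mono order_refl Delta_J_nonneg) auto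
    finally show ?thesis .
  qed
  finally have *: "enn2ereal (\<integral>\<^sup>+\<theta>. D \<theta> * q \<theta> \<partial>T)
      \<le> ereal \<alpha> * Psi \<alpha> T lik latent prior \<theta>0 y q qS + ereal (ln (1 / \<zeta>))"
    by (simp add: add_right_mono)
  have "eintegral T (\<lambda>\<theta>. ereal (1 - \<alpha>) * Renyi_div \<alpha> \<nu> (p \<theta>) (p \<theta>0) * enn2ereal (q \<theta>))
      = enn2ereal (\<integral>\<^sup>+\<theta>. D \<theta> * q \<theta> \<partial>T)"
    using \<alpha> by (subst eintegral_nonneg_eq)
      (simp_all add: e2ennreal_mult_enn2ereal D_def Renyi_div_nonneg[OF pd p0 \<alpha>])
  then show ?thesis
    using * by simp
qed

theorem theorem3p1:
  fixes n :: nat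
    and Y :: "nat \<Rightarrow> 'y measure"
    and \<nu> :: "(nat \<Rightarrow> 'y) measure"
    and T :: "('m \<times> 'w) measure"
    and lik :: "'m \<Rightarrow> 's :: countable \<Rightarrow> (nat \<Rightarrow> 'y) \<Rightarrow> ennreal"
    and latent :: "'m \<times> 'w \<Rightarrow> 's pmf"
    and prior :: "'m \<times> 'w \<Rightarrow> ennreal"
    and \<theta>0 :: "'m \<times> 'w"
    and \<Gamma>\<theta> :: "('m \<times> 'w \<Rightarrow> ennreal) set"
    and \<Gamma>S :: "'s pmf set"
    and vb :: "(nat \<Rightarrow> 'y) \<Rightarrow> ('m \<times> 'w \<Rightarrow> ennreal) \<times> 's pmf"
    and \<alpha> \<zeta> :: real
  defines "P0 \<equiv> density \<nu> (data_density lik latent \<theta>0)"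
  assumes n: "n \<ge> 1"
    and sample_space: "sets \<nu> = sets (\<Pi>\<^sub>M i\<in>{1..n}. Y i)"
    and lik_measurable:
      "\<And>s. (\<lambda>(\<theta>, y). lik (fst \<theta>) s y) \<in> borel_measurable (T \<Otimes>\<^sub>M \<nu>)"
    and lik_density: "\<And>\<theta> s. \<theta> \<in> space T \<Longrightarrow> prob_density \<nu> (lik (fst \<theta>) s)"
    and latent_measurable: "\<And>s. (\<lambda>\<theta>. pmf (latent \<theta>) s) \<in> borel_measurable T"
    and prior: "prob_density T prior"
    and true_parameter: "\<theta>0 \<in> space T"
    and \<Gamma>\<theta>_densities: "\<And>q. q \<in> \<Gamma>\<theta> \<Longrightarrow> prob_density T q"
    and \<alpha>: "0 < \<alpha>" "\<alpha> < 1"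
    and \<zeta>: "0 < \<zeta>" "\<zeta> < 1"
    and vb_solution:
      "AE y in P0. is_arg_min (\<lambda>(q, qS). Psi \<alpha> T lik latent prior \<theta>0 y q qS)
                              (\<lambda>x. x \<in> \<Gamma>\<theta> \<times> \<Gamma>S) (vb y)"
  shows "\<exists>A \<in> sets P0. measure P0 A \<ge> 1 - \<zeta> \<and>
    (\<forall>y\<in>A. \<forall>q\<in>\<Gamma>\<theta>. \<forall>qS\<in>\<Gamma>S.
       absolutely_continuous (density T prior) (density T q) \<longrightarrow>
       eintegral T (\<lambda>\<theta>. ereal (1 / real n)
           * Renyi_div \<alpha> \<nu> (data_density lik latent \<theta>) (data_density lik latent \<theta>0)
           * enn2ereal (fst (vb y) \<theta>))
       \<le> ereal (\<alpha> / (real n * (1 - \<alpha>))) * Psi \<alpha> T lik latent prior \<theta>0 y q qS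
         + ereal (1 / (real n * (1 - \<alpha>)) * ln (1 / \<zeta>)))"
proof -
  define p where "p = data_density lik latent"
  have pd: "prob_density \<nu> (p \<theta>)" if "\<theta> \<in> space T" for \<theta>
    unfolding p_def by (intro prob_density_data_density lik_density that)
  note p0 = pd[OF true_parameter]
  have pm: "case_prod p \<in> borel_measurable (T \<Otimes>\<^sub>M \<nu>)"
    unfolding p_def by (rule borel_measurable_data_density[OF lik_measurable latent_measurable])
  have P0: "P0 = density \<nu> (p \<theta>0)"
    by (simp add: P0_def p_def)
  note event = high_probability_event[OF pm pd p0 prior \<alpha> \<zeta>]
  have aff [measurable]: "(\<lambda>\<theta>. affinity \<alpha> \<nu> (p \<theta>) (p \<theta>0)) \<in> borel_measurable T"
    by (rule event(1))
  obtain B where B: "B \<in> sets P0" "measure P0 B \<ge> 1 - \<zeta>"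
    "\<And>y. y \<in> B \<Longrightarrow> 0 < p \<theta>0 y \<and> p \<theta>0 y < \<infinity> \<and>
      (\<integral>\<^sup>+\<theta>. prior \<theta> * (ratio_powr \<alpha> (p \<theta> y) (p \<theta>0 y) / affinity \<alpha> \<nu> (p \<theta>) (p \<theta>0)) \<partial>T)
        \<le> ennreal (1 / \<zeta>)"
    using event(2) unfolding P0 by auto
  \<comment> \<open>The exceptional set of \<open>vb_solution\<close> is null, so removing it from
    \<open>B\<close> keeps the probability. Neither set depends on \<open>q\<close> or
    \<open>qS\<close>, which makes the bound simultaneous.\<close>
  obtain N where N: "N \<in> null_sets P0"
    "\<And>y. y \<in> space P0 - N \<Longrightarrow> is_arg_min (\<lambda>(q, qS). Psi \<alpha> T lik latent prior \<theta>0 y q qS)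
                              (\<lambda>x. x \<in> \<Gamma>\<theta> \<times> \<Gamma>S) (vb y)"
    using AE_E3[OF vb_solution] by blast
  have c: "0 < 1 / (real n * (1 - \<alpha>))"
    using n \<alpha> by simp
  have "eintegral T (\<lambda>\<theta>. ereal (1 / real n) * Renyi_div \<alpha> \<nu> (p \<theta>) (p \<theta>0) * enn2ereal (fst (vb y) \<theta>))
       \<le> ereal (\<alpha> / (real n * (1 - \<alpha>))) * Psi \<alpha> T lik latent prior \<theta>0 y q qS
         + ereal (1 / (real n * (1 - \<alpha>)) * ln (1 / \<zeta>))"
    if y: "y \<in> B - N" and q: "q \<in> \<Gamma>\<theta>" and qS: "qS \<in> \<Gamma>S" for y q qS
  proof -
    have sp: "y \<in> space P0" "y \<in> space \<nu>"
      using y sets.sets_into_space[OF B(1)] by (auto simp: P0)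
    obtain q' qS' where vb: "vb y = (q', qS')"
      by fastforce
    have "q' \<in> \<Gamma>\<theta>" and min: "Psi \<alpha> T lik latent prior \<theta>0 y q' qS' \<le> Psi \<alpha> T lik latent prior \<theta>0 y q qS"
      using N(2)[of y] y sp q qS by (auto simp: is_arg_min_def vb not_less)
    note q' = \<Gamma>\<theta>_densities[OF this(1)]
    have [measurable]: "q' \<in> borel_measurable T"
      using q' by (simp add: prob_density_def)
    have eq: "ereal (1 / real n) = ereal (1 / (real n * (1 - \<alpha>))) * ereal (1 - \<alpha>)"
      "ereal (\<alpha> / (real n * (1 - \<alpha>))) = ereal (1 / (real n * (1 - \<alpha>))) * ereal \<alpha>"
      using \<alpha> by simp_all
    have "eintegral T (\<lambda>\<theta>. ereal (1 / real n) * Renyi_div \<alpha> \<nu> (p \<theta>) (p \<theta>0) * enn2ereal (q' \<theta>))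
       = ereal (1 / (real n * (1 - \<alpha>)))
         * eintegral T (\<lambda>\<theta>. ereal (1 - \<alpha>) * Renyi_div \<alpha> \<nu> (p \<theta>) (p \<theta>0) * enn2ereal (q' \<theta>))"
      unfolding eq(1) mult.assoc using c unfolding Renyi_div_affinity
      by (intro eintegral_cmult) measurable
    \<comment> \<open>The bound is applied to the minimiser itself; \<open>min\<close> then replaces
      its objective value by that of the competitor.\<close>
    also have "\<dots> \<le> ereal (1 / (real n * (1 - \<alpha>)))
        * (ereal \<alpha> * Psi \<alpha> T lik latent prior \<theta>0 y q' qS' + ereal (ln (1 / \<zeta>)))"
      using B(3)[of y] y sp c
      by (intro ereal_mult_left_mono Psi_bound[where lik = lik and latent = latent, folded p_def] pm pd p0 prior q' \<alpha> \<zeta> aff) auto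
    also have "\<dots> \<le> ereal (1 / (real n * (1 - \<alpha>)))
        * (ereal \<alpha> * Psi \<alpha> T lik latent prior \<theta>0 y q qS + ereal (ln (1 / \<zeta>)))"
      using c \<alpha> min by (intro ereal_mult_left_mono add_mono order_refl) auto
    also have "\<dots> = ereal (\<alpha> / (real n * (1 - \<alpha>))) * Psi \<alpha> T lik latent prior \<theta>0 y q qS
         + ereal (1 / (real n * (1 - \<alpha>)) * ln (1 / \<zeta>))"
      unfolding eq(2) mult.assoc using c by (subst ereal_pos_distrib) simp_all
    finally show ?thesis
      by (simp add: vb)
  qed
  moreover have "B - N \<in> sets P0" "measure P0 (B - N) = measure P0 B"
    using B(1) N(1) by (auto simp: measure_Diff_null_set)
  ultimately show ?thesis
    using B(2) unfolding p_def by (intro bexI[of _ "B - N"]) auto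
qed

end
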